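(* For every test $T:A\to B$ on $2^{\mathbb N}$ there exists a Borel probability measure $\mu$ on $2^{\mathbb N}$ which passes $T$, i.e. such that $T(\mu)(\sigma)\le \mu(\sigma)$ for all $\sigma\in 2^{<\mathbb N}$.
   Context: $2^{<\mathbb N}$ is the set of finite binary strings, $\emptyset$ the empty string, $|\sigma|$ the length of $\sigma$, and $\sigma\,\hat{}\,\tau$ denotes concatenation. A Borel probability measure on Cantor space $2^{\mathbb N}$ is identified with its values on cylinder sets, i.e. with a function $\mu:2^{<\mathbb N}\to[0,1]$ such that $\mu(\emptyset)=1$ and $\mu(\sigma)=\mu(\sigma\,\hat{}\,0)+\mu(\sigma\,\hat{}\,1)$. A (continuous probability) semimeasure is a function $\mu:2^{<\mathbb N}\to[0,1]$ with $\mu(\emptyset)=1$ and $\mu(\sigma)\ge\mu(\sigma\,\hat{}\,0)+\mu(\sigma\,\hat{}\,1)$ for all $\sigma$. Conditions on measures: $A$ is the set of partial functions $f=(f_1,f_2)$ with finite domain $\mathrm{dom}(f)\subset 2^{<\mathbb N}$ and values in $\{n/2^k:n,k\in\mathbb N\}^2$, such that there is a Borel probability measure $\mu$ with $f_1(\sigma)<\mu(\sigma)<f_2(\sigma)$ for all $\sigma\in\mathrm{dom}(f)$; in this case we write $\mu\models f$. Order: $f\le_A g$ iff $\mathrm{dom}(f)\subseteq\mathrm{dom}(g)$ and $[f_1(\sigma),f_2(\sigma)]\supseteq[g_1(\sigma),g_2(\sigma)]$ for all $\sigma\in\mathrm{dom}(f)$. Conditions on semimeasures: $B$ is the set of semimeasures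 with rational values for which there is $n$ such that $|\sigma|>n$ implies the value at $\sigma$ is $0$. Order: $x\le_B y$ iff $x(\sigma)\le y(\sigma)$ for all $\sigma$. A test on $2^{\mathbb N}$ is a nondecreasing function $T:(A,\le_A)\to(B,\le_B)$. For a Borel probability measure $\mu$, $T(\mu)$ denotes the semimeasure $T(\mu)(\sigma)=\sup\{T(a)(\sigma): a\in A,\ \mu\models a\}$. *)

theory Defs
  imports Complex_Main
begin

text \<open>
  Finite binary strings are lists of booleans, with \<^term>\<open>False\<close> for 0 and \<^term>\<open>True\<close> for 1; an infinite
  sequence extends \<open>\<sigma>\<close> if \<open>\<sigma>\<close>, read from its head, is an initial segment of it.
\<close>

type_synonym bstring = "bool list"

text \<open>
  Borel probability measures on Cantor space are identified with their values on cylinder sets.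
\<close>

definition cantor_prob_measure :: "(bstring \<Rightarrow> real) \<Rightarrow> bool" where
  "cantor_prob_measure \<mu> \<longleftrightarrow>
     (\<forall>\<sigma>. 0 \<le> \<mu> \<sigma> \<and> \<mu> \<sigma> \<le> 1) \<and> \<mu> [] = 1 \<and>
     (\<forall>\<sigma>. \<mu> \<sigma> = \<mu> (\<sigma> @ [False]) + \<mu> (\<sigma> @ [True]))"

definition semimeasure :: "(bstring \<Rightarrow> real) \<Rightarrow> bool" where
  "semimeasure \<mu> \<longleftrightarrow>
     (\<forall>\<sigma>. 0 \<le> \<mu> \<sigma> \<and> \<mu> \<sigma> \<le> 1) \<and> \<mu> [] = 1 \<and>
     (\<forall>\<sigma>. \<mu> \<sigma> \<ge> \<mu> (\<sigma> @ [False]) + \<mu> (\<sigma> @ [True]))"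

definition nonneg_dyadics :: "real set" where
  "nonneg_dyadics = {real n / 2 ^ k | n k :: nat. True}"

type_synonym mcond = "bstring \<rightharpoonup> real \<times> real"

definition satisfies :: "(bstring \<Rightarrow> real) \<Rightarrow> mcond \<Rightarrow> bool" (infix \<open>\<Turnstile>\<close> 50) where
  "\<mu> \<Turnstile> f \<longleftrightarrow> (\<forall>\<sigma>\<in>dom f. fst (the (f \<sigma>)) < \<mu> \<sigma> \<and> \<mu> \<sigma> < snd (the (f \<sigma>)))"

definition A_cond :: "mcond set" where
  "A_cond = {f. finite (dom f) \<and> ran f \<subseteq> nonneg_dyadics \<times> nonneg_dyadics \<and>
                (\<exists>\<mu>. cantor_prob_measure \<mu> \<and> \<mu> \<Turnstile> f)}"

definition A_le :: "mcond \<Rightarrow> mcond \<Rightarrow> bool" (infix \<open>\<le>\<^sub>A\<close> 50) where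
  "f \<le>\<^sub>A g \<longleftrightarrow> dom f \<subseteq> dom g \<and>
     (\<forall>\<sigma>\<in>dom f. {fst (the (g \<sigma>))..snd (the (g \<sigma>))} \<subseteq> {fst (the (f \<sigma>))..snd (the (f \<sigma>))})"

definition B_cond :: "(bstring \<Rightarrow> real) set" where
  "B_cond = {x. semimeasure x \<and> range x \<subseteq> \<rat> \<and> (\<exists>n. \<forall>\<sigma>. length \<sigma> > n \<longrightarrow> x \<sigma> = 0)}"

definition B_le :: "(bstring \<Rightarrow> real) \<Rightarrow> (bstring \<Rightarrow> real) \<Rightarrow> bool" (infix \<open>\<le>\<^sub>B\<close> 50) where
  "x \<le>\<^sub>B y \<longleftrightarrow> (\<forall>\<sigma>. x \<sigma> \<le> y \<sigma>)"

text \<open>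
  A test is a function on the conditions in \<^term>\<open>A_cond\<close>; its values elsewhere are irrelevant.
\<close>

definition is_test :: "(mcond \<Rightarrow> bstring \<Rightarrow> real) \<Rightarrow> bool" where
  "is_test T \<longleftrightarrow> T ` A_cond \<subseteq> B_cond \<and> monotone_on A_cond (\<le>\<^sub>A) (\<le>\<^sub>B) T"

text \<open>
  For a test and a measure the set below is bounded by 1, and it is nonempty because every measure
  satisfies the condition with empty domain; so the real supremum is the genuine one.
\<close>

definition test_value :: "(mcond \<Rightarrow> bstring \<Rightarrow> real) \<Rightarrow> (bstring \<Rightarrow> real) \<Rightarrow> bstring \<Rightarrow> real" where
  "test_value T \<mu> \<sigma> = Sup {T a \<sigma> | a. a \<in> A_cond \<and> \<mu> \<Turnstile> a}"

definition passes :: "(bstring \<Rightarrow> real) \<Rightarrow> (mcond \<Rightarrow> bstring \<Rightarrow> real) \<Rightarrow> bool" where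
  "passes \<mu> T \<longleftrightarrow> (\<forall>\<sigma>. test_value T \<mu> \<sigma> \<le> \<mu> \<sigma>)"

end

theory Submission
  imports Defs "HOL-Analysis.Analysis"
begin

text \<open>
  For finitely many conditions, being violated at \<open>p\<close> is measured by continuous nonnegative weights
  \<open>g p \<tau>\<close>, positive iff some condition \<open>a\<close> satisfied by \<open>p\<close> has \<open>T a \<tau> > p \<tau>\<close>. A variational
  inequality yields a measure \<open>p\<close> maximising \<open>\<nu> \<mapsto> \<Sum>\<tau>. g p \<tau> * \<nu> \<tau>\<close> over all measures \<open>\<nu>\<close>.
  The conditions satisfied by \<open>p\<close> have an upper bound \<open>c\<close>, and some measure \<open>\<nu> \<ge> T c\<close> beats \<open>p\<close>
  at every \<open>\<tau>\<close> of positive weight; so all weights vanish. Compactness of the space of measures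
  then handles all conditions at once.

  The maximiser is found by describing measures through their conditional probabilities, which
  form a cube: a Brouwer fixed point of the map shifting each conditional probability towards the
  child with the larger expected weight is optimal at every node.
\<close>

section \<open>Brouwer's fixed point theorem in a cube of countable dimension\<close>

lemma tendsto_fun_componentwise:
  fixes f :: "'c \<Rightarrow> 'a \<Rightarrow> 'b::topological_space"
  assumes "\<And>i. ((\<lambda>x. f x i) \<longlongrightarrow> l i) F"
  shows "(f \<longlongrightarrow> l) F"
proof -
  have "limitin (product_topology (\<lambda>i. euclidean) UNIV) f l F"
    using assms by (simp add: limitin_componentwise)
  then show ?thesis
    by (simp add: euclidean_product_topology)
qed

lemma compact_cube: "compact {x :: 'a \<Rightarrow> real. \<forall>i. x i \<in> {0..1}}"
proof -
  have "{x :: 'a \<Rightarrow> real. \<forall>i. x i \<in> {0..1}} = PiE UNIV (\<lambda>i. {0..1})"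
    by auto
  moreover have "compactin (product_topology (\<lambda>i. euclidean) UNIV) (PiE UNIV (\<lambda>i::'a. {0..1::real}))"
    by (subst compactin_PiE) auto
  ultimately show ?thesis
    by (simp add: euclidean_product_topology)
qed

text \<open>Kuhn's combinatorial lemma on the grid of mesh \<open>1 / Suc n\<close> in the first
  \<open>n\<close> coordinates, the others being 0: some cell has, for every \<open>i < n\<close>,
  vertices of both labels in direction \<open>i\<close>. The opposite signs of the displacement of
  \<open>f\<close> at these nearby points force a fixed point in the limit, once \<open>f\<close> is
  continuous.\<close>

lemma kuhn_cube_approximation:
  fixes f :: "(nat \<Rightarrow> real) \<Rightarrow> nat \<Rightarrow> real" and n :: nat
  defines "K \<equiv> {x. \<forall>i. x i \<in> {0..1}}"
  assumes f: "f \<in> K \<rightarrow> K"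
  shows "\<exists>q\<in>K. \<forall>i<n. \<exists>r s. r \<in> K \<and> s \<in> K \<and> (\<forall>j. \<bar>r j - q j\<bar> \<le> 1 / Suc n) \<and> (\<forall>j. \<bar>s j - q j\<bar> \<le> 1 / Suc n) \<and>
           r i \<le> f r i \<and> f s i \<le> s i"
proof -
  define e :: "(nat \<Rightarrow> nat) \<Rightarrow> nat \<Rightarrow> real"
    where "e x = (\<lambda>i. if i < n then x i / Suc n else 0)" for x
  have eK: "e x \<in> K" if "\<forall>i<n. x i \<le> Suc n" for x
    using that by (auto simp: K_def e_def divide_simps)
  have fK: "0 \<le> f x i" "f x i \<le> 1" if "x \<in> K" for x i
    using f that by (auto simp: K_def)
  \<comment> \<open>Label 0 means that \<open>f\<close> does not decrease coordinate
    \<open>i\<close>. Kuhn's lemma wants label 1 on the upper face \<open>x i = Suc n\<close>; the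
    coordinate is 1 there, so label 1 still means that \<open>f\<close> does not increase
    it.\<close>
  define lab :: "(nat \<Rightarrow> nat) \<Rightarrow> nat \<Rightarrow> nat"
    where "lab x i = (if e x i \<le> f (e x) i \<and> x i \<noteq> Suc n then 0 else 1)" for x i
  obtain q where q: "\<forall>i<n. q i < Suc n" and
    rs: "\<forall>i<n. \<exists>r s. (\<forall>j<n. q j \<le> r j \<and> r j \<le> q j + 1) \<and> (\<forall>j<n. q j \<le> s j \<and> s j \<le> q j + 1) \<and> lab r i \<noteq> lab s i"
  proof (rule kuhn_lemma[of "Suc n" n lab])
    show "\<forall>x. (\<forall>i<n. x i \<le> Suc n) \<longrightarrow> (\<forall>i<n. x i = 0 \<longrightarrow> lab x i = 0)"
    proof (intro allI impI)
      fix x i assume x: "\<forall>i<n. x i \<le> Suc n" and "i < n" "x i = 0"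
      then show "lab x i = 0"
        using fK(1)[OF eK[OF x], of i] by (simp add: lab_def e_def)
    qed
  qed (auto simp: lab_def)
  have "\<exists>r s. r \<in> K \<and> s \<in> K \<and> (\<forall>j. \<bar>r j - e q j\<bar> \<le> 1 / Suc n) \<and> (\<forall>j. \<bar>s j - e q j\<bar> \<le> 1 / Suc n) \<and>
           r i \<le> f r i \<and> f s i \<le> s i" if i: "i < n" for i
  proof -
    have near: "\<bar>e r j - e q j\<bar> \<le> 1 / Suc n" if "\<forall>j<n. q j \<le> r j \<and> r j \<le> q j + 1" for r j
    proof (cases "j < n")
      case True
      then have "real (q j) \<le> r j" "real (r j) \<le> q j + 1"
        using that by (simp, metis of_nat_1 of_nat_add of_nat_le_iff)
      then show ?thesis
        using True by (simp add: e_def abs_le_iff flip: diff_divide_distrib) (simp add: divide_simps)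
    qed (simp add: e_def)
    have inK: "e r \<in> K" if "\<forall>j<n. q j \<le> r j \<and> r j \<le> q j + 1" for r
      using that q by (intro eK) fastforce
    have lab0: "e r i \<le> f (e r) i" if "lab r i = 0" for r
      using that by (simp add: lab_def split: if_splits)
    have lab1: "f (e r) i \<le> e r i" if "lab r i \<noteq> 0" "\<forall>j<n. q j \<le> r j \<and> r j \<le> q j + 1" for r
      using that(1) fK(2)[OF inK[OF that(2)], of i] i by (auto simp: lab_def e_def split: if_splits)
    obtain r s where r: "\<forall>j<n. q j \<le> r j \<and> r j \<le> q j + 1" and s: "\<forall>j<n. q j \<le> s j \<and> s j \<le> q j + 1"
      and ne: "lab r i \<noteq> lab s i"
      using rs i by blast
    show ?thesis
    proof (cases "lab r i = 0")
      case True
      with ne have "lab s i \<noteq> 0" by simp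
      then show ?thesis
        using True near[OF r] near[OF s] inK[OF r] inK[OF s] lab0[of r] lab1[OF _ s] by blast
    next
      case False
      then have "lab s i = 0" using ne by (auto simp: lab_def split: if_splits)
      then show ?thesis
        using False near[OF r] near[OF s] inK[OF r] inK[OF s] lab0[of s] lab1[OF _ r] by blast
    qed
  qed
  moreover have "e q \<in> K"
    using q by (intro eK) (simp add: less_imp_le)
  ultimately show ?thesis by blast
qed

text \<open>
  The grid approximations refine the mesh and raise the dimension simultaneously, so a single
  convergent subsequence in the compact infinite-dimensional cube suffices.
\<close>

lemma brouwer_nat_cube:
  fixes f :: "(nat \<Rightarrow> real) \<Rightarrow> nat \<Rightarrow> real"
  defines "K \<equiv> {x. \<forall>i. x i \<in> {0..1}}"
  assumes cont: "continuous_on K f" and f: "f \<in> K \<rightarrow> K"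
  obtains x where "x \<in> K" "f x = x"
proof -
  define P where "P q n i r s \<longleftrightarrow> r \<in> K \<and> s \<in> K \<and> (\<forall>j. \<bar>r j - q j\<bar> \<le> 1 / Suc n) \<and>
      (\<forall>j. \<bar>s j - q j\<bar> \<le> 1 / Suc n) \<and> r i \<le> f r i \<and> f s i \<le> s i"
    for q r s :: "nat \<Rightarrow> real" and n i
  have "\<exists>q\<in>K. \<forall>i<n. \<exists>r s. P q n i r s" for n
    using kuhn_cube_approximation[OF f[unfolded K_def], of n] unfolding P_def K_def .
  then obtain q where q: "\<And>n. q n \<in> K" and "\<And>n i. i < n \<Longrightarrow> \<exists>r s. P (q n) n i r s"
    by metis
  then have "\<forall>n i. \<exists>r s. i < n \<longrightarrow> P (q n) n i r s"
    by blast
  then obtain r s where P: "\<And>n i. i < n \<Longrightarrow> P (q n) n i (r n i) (s n i)"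
    unfolding choice_iff by blast
  have
    rK: "\<And>n i. i < n \<Longrightarrow> r n i \<in> K" and sK: "\<And>n i. i < n \<Longrightarrow> s n i \<in> K" and
    rq: "\<And>n i j. i < n \<Longrightarrow> \<bar>r n i j - q n j\<bar> \<le> 1 / Suc n" and
    sq: "\<And>n i j. i < n \<Longrightarrow> \<bar>s n i j - q n j\<bar> \<le> 1 / Suc n" and
    r: "\<And>n i. i < n \<Longrightarrow> r n i i \<le> f (r n i) i" and
    s: "\<And>n i. i < n \<Longrightarrow> f (s n i) i \<le> s n i i"
    using P unfolding P_def by blast+
  obtain x h where x: "x \<in> K" and h: "strict_mono (h :: nat \<Rightarrow> nat)" and lim: "(q \<circ> h) \<longlonglongrightarrow> x"
    using compact_cube[where 'a = nat] q unfolding K_def[symmetric] compact_def by metis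
  have coord: "(\<lambda>k. q (h k) j) \<longlonglongrightarrow> x j" for j
  proof -
    have "continuous_on UNIV (\<lambda>z :: nat \<Rightarrow> real. z j)" by simp
    then have "(\<lambda>k. (q \<circ> h) k j) \<longlonglongrightarrow> x j"
      using lim by (rule continuous_on_tendsto_compose) auto
    then show ?thesis by simp
  qed
  have large: "\<forall>\<^sub>F k in sequentially. i < h k" for i
    using eventually_compose_filterlim[OF eventually_gt_at_top filterlim_subseq[OF h]] .
  have small: "(\<lambda>k. 1 / real (Suc (h k))) \<longlonglongrightarrow> 0"
    using LIMSEQ_subseq_LIMSEQ[OF LIMSEQ_inverse_real_of_nat h] by (simp add: o_def field_simps)
  \<comment> \<open>\<open>r n i\<close> and \<open>s n i\<close> are controlled only for
    \<open>i < n\<close>. For fixed \<open>i\<close> this holds eventually along \<open>h\<close>,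
    and the mesh tends to 0, so both sequences converge to \<open>x\<close>; the two opposite
    inequalities then pass to the limit.\<close>
  have near: "(\<lambda>k. u (h k) i) \<longlonglongrightarrow> x \<and> (\<lambda>k. f (u (h k) i) i) \<longlonglongrightarrow> f x i"
    if uK: "\<And>n i. i < n \<Longrightarrow> u n i \<in> K" and uq: "\<And>n i j. i < n \<Longrightarrow> \<bar>u n i j - q n j\<bar> \<le> 1 / Suc n"
    for u :: "nat \<Rightarrow> nat \<Rightarrow> nat \<Rightarrow> real" and i
  proof
    show *: "(\<lambda>k. u (h k) i) \<longlonglongrightarrow> x"
    proof (rule tendsto_fun_componentwise)
      fix j
      have "(\<lambda>k. u (h k) i j - q (h k) j) \<longlonglongrightarrow> 0"
        by (rule Lim_null_comparison[OF _ small]) (use large[of i] in \<open>auto elim!: eventually_mono dest: uq\<close>)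
      from tendsto_add[OF this coord[of j]] show "(\<lambda>k. u (h k) i j) \<longlonglongrightarrow> x j"
        by simp
    qed
    have "continuous_on K (\<lambda>z. f z i)"
      using cont by (rule continuous_on_product_then_coordinatewise)
    then show "(\<lambda>k. f (u (h k) i) i) \<longlonglongrightarrow> f x i"
      using * x by (rule continuous_on_tendsto_compose) (use large[of i] in \<open>auto elim!: eventually_mono intro: uK\<close>)
  qed
  have coord': "(\<lambda>k. u k j) \<longlonglongrightarrow> x j" if "u \<longlonglongrightarrow> x" for u :: "nat \<Rightarrow> nat \<Rightarrow> real" and j
    by (rule continuous_on_tendsto_compose[OF _ that, of UNIV "\<lambda>z. z j"]) auto
  have "f x i = x i" for i
  proof (rule antisym)
    show "f x i \<le> x i"
      by (rule tendsto_le[OF _ coord'[OF conjunct1[OF near[OF sK sq]]] conjunct2[OF near[OF sK sq]]])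
         (use large[of i] s in \<open>auto elim!: eventually_mono\<close>)
    show "x i \<le> f x i"
      by (rule tendsto_le[OF _ conjunct2[OF near[OF rK rq]] coord'[OF conjunct1[OF near[OF rK rq]]]])
         (use large[of i] r in \<open>auto elim!: eventually_mono\<close>)
  qed
  with x that show thesis by blast
qed

text \<open>Reindexing along \<open>to_nat\<close> reduces this to sequences. \<open>to_nat\<close>
  need not be onto, but \<open>g\<close> reads only coordinates in its range, so restricting a fixed
  point of \<open>g\<close> to that range gives one of \<open>f\<close>.\<close>

lemma brouwer_countable_cube:
  fixes f :: "('i::countable \<Rightarrow> real) \<Rightarrow> 'i \<Rightarrow> real"
  defines "K \<equiv> {x. \<forall>i. x i \<in> {0..1}}"
  assumes cont: "continuous_on K f" and f: "f \<in> K \<rightarrow> K"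
  obtains x where "x \<in> K" "f x = x"
proof -
  define g where "g y k = f (\<lambda>i. y (to_nat i)) (from_nat k)" for y :: "nat \<Rightarrow> real" and k
  let ?N = "{y :: nat \<Rightarrow> real. \<forall>k. y k \<in> {0..1}}"
  have "continuous_on ?N (\<lambda>y. \<lambda>i::'i. y (to_nat i))"
    by (intro continuous_on_coordinatewise_then_product) (rule continuous_on_subset[OF continuous_on_product_coordinates], simp)
  then have "continuous_on ?N (\<lambda>y. f (\<lambda>i. y (to_nat i)))"
    by (rule continuous_on_compose2[OF cont]) (auto simp: K_def)
  then have "continuous_on ?N g"
    unfolding g_def [abs_def]
    by (rule continuous_on_coordinatewise_then_product[OF continuous_on_product_then_coordinatewise])
  moreover have "g \<in> ?N \<rightarrow> ?N"
  proof
    fix y assume "y \<in> ?N"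
    then have "(\<lambda>i. y (to_nat i)) \<in> K" unfolding K_def by blast
    then have "f (\<lambda>i. y (to_nat i)) \<in> K" using f by blast
    then show "g y \<in> ?N" unfolding K_def g_def by blast
  qed
  ultimately obtain y where y: "y \<in> ?N" "g y = y"
    by (rule brouwer_nat_cube)
  show thesis
  proof
    show "(\<lambda>i. y (to_nat i)) \<in> K" using y by (auto simp: K_def)
    have "f (\<lambda>i. y (to_nat i)) i = y (to_nat i)" for i
      using fun_cong[OF y(2), of "to_nat i"] by (simp add: g_def)
    then show "f (\<lambda>i. y (to_nat i)) = (\<lambda>i. y (to_nat i))" by auto
  qed
qed

section \<open>Measures from conditional probabilities\<close>

text \<open>\<open>\<theta> \<sigma>\<close> is the conditional probability of \<open>True\<close> after \<open>\<sigma>\<close>; the recursion runs over reversed strings.\<close>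

primrec prob_of_choices :: "(bstring \<Rightarrow> real) \<Rightarrow> bstring \<Rightarrow> real" where
  "prob_of_choices \<theta> [] = 1"
| "prob_of_choices \<theta> (b # \<rho>) = prob_of_choices \<theta> \<rho> * (if b then \<theta> (rev \<rho>) else 1 - \<theta> (rev \<rho>))"

definition choice_measure :: "(bstring \<Rightarrow> real) \<Rightarrow> bstring \<Rightarrow> real" where
  "choice_measure \<theta> \<sigma> = prob_of_choices \<theta> (rev \<sigma>)"

lemma choice_measure_simps [simp]:
  "choice_measure \<theta> [] = 1"
  "choice_measure \<theta> (\<sigma> @ [True]) = choice_measure \<theta> \<sigma> * \<theta> \<sigma>"
  "choice_measure \<theta> (\<sigma> @ [False]) = choice_measure \<theta> \<sigma> * (1 - \<theta> \<sigma>)"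
  by (simp_all add: choice_measure_def)

lemma cantor_prob_measure_choice_measure:
  assumes "\<And>\<sigma>. \<theta> \<sigma> \<in> {0..1}"
  shows "cantor_prob_measure (choice_measure \<theta>)"
proof -
  have "0 \<le> choice_measure \<theta> \<sigma> \<and> choice_measure \<theta> \<sigma> \<le> 1" for \<sigma>
  proof (induction \<sigma> rule: rev_induct)
    case (snoc b \<sigma>)
    then show ?case using assms[of \<sigma>] by (cases b) (auto intro!: mult_le_one)
  qed simp
  then show ?thesis by (simp add: cantor_prob_measure_def algebra_simps)
qed

lemma continuous_on_choice_measure: "continuous_on S choice_measure"
proof (rule continuous_on_coordinatewise_then_product)
  fix \<sigma>
  have coord: "continuous_on S (\<lambda>\<theta> :: bstring \<Rightarrow> real. \<theta> \<tau>)" for \<tau>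
    by (rule continuous_on_subset[OF continuous_on_product_coordinates]) simp
  show "continuous_on S (\<lambda>\<theta>. choice_measure \<theta> \<sigma>)"
  proof (induction \<sigma> rule: rev_induct)
    case (snoc b \<sigma>)
    then show ?case by (cases b) (auto intro!: continuous_intros coord)
  qed simp
qed

section \<open>Backward induction and the variational inequality\<close>

text \<open>Backward induction: the expected total weight \<open>w\<close> of the next \<open>m\<close> levels, starting at \<open>\<sigma>\<close>.\<close>

primrec tree_value :: "(bstring \<Rightarrow> real) \<Rightarrow> (bstring \<Rightarrow> real) \<Rightarrow> nat \<Rightarrow> bstring \<Rightarrow> real" where
  "tree_value w \<theta> 0 \<sigma> = w \<sigma>"
| "tree_value w \<theta> (Suc m) \<sigma> = w \<sigma> + \<theta> \<sigma> * tree_value w \<theta> m (\<sigma> @ [True])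
     + (1 - \<theta> \<sigma>) * tree_value w \<theta> m (\<sigma> @ [False])"

lemma finite_bstring_length_le [simp]: "finite {\<tau> :: bstring. length \<tau> \<le> n}"
  using finite_lists_length_le[of "UNIV :: bool set" n] by simp

text \<open>Splitting by the first letter matches the recursion of \<open>tree_value\<close>,
  because \<open>\<sigma> @ b # \<tau> = (\<sigma> @ [b]) @ \<tau>\<close>.\<close>

lemma sum_bstring_length_le_Suc:
  fixes h :: "bstring \<Rightarrow> real"
  shows "(\<Sum>\<tau> | length \<tau> \<le> Suc m. h \<tau>) =
    h [] + (\<Sum>\<tau> | length \<tau> \<le> m. h (True # \<tau>)) + (\<Sum>\<tau> | length \<tau> \<le> m. h (False # \<tau>))"
proof -
  let ?L = "{\<tau> :: bstring. length \<tau> \<le> m}"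
  have eq: "{\<tau> :: bstring. length \<tau> \<le> Suc m} = insert [] ((#) True ` ?L \<union> (#) False ` ?L)"
  proof (intro set_eqI)
    fix \<tau> :: bstring
    show "\<tau> \<in> {\<tau>. length \<tau> \<le> Suc m} \<longleftrightarrow> \<tau> \<in> insert [] ((#) True ` ?L \<union> (#) False ` ?L)"
      by (cases \<tau>) auto
  qed
  have "(\<Sum>\<tau> | length \<tau> \<le> Suc m. h \<tau>) = h [] + (sum h ((#) True ` ?L) + sum h ((#) False ` ?L))"
    unfolding eq by (subst sum.insert) (auto intro!: sum.union_disjoint)
  then show ?thesis by (simp add: sum.reindex inj_on_def)
qed

lemma tree_sum_choice_measure:
  "(\<Sum>\<tau> | length \<tau> \<le> m. w (\<sigma> @ \<tau>) * choice_measure \<theta> (\<sigma> @ \<tau>)) = choice_measure \<theta> \<sigma> * tree_value w \<theta> m \<sigma>"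
proof (induction m arbitrary: \<sigma>)
  case (Suc m)
  show ?case
    using Suc[of "\<sigma> @ [True]"] Suc[of "\<sigma> @ [False]"]
    by (simp add: sum_bstring_length_le_Suc algebra_simps)
qed simp

text \<open>Dynamic programming: where every node is worth its own weight plus the value of its
  better child, no way of splitting mass collects more. The fixed sum \<open>n\<close> ties the
  depth of a node to the number of levels still below it.\<close>

lemma tree_sum_le_tree_value:
  assumes \<nu>: "cantor_prob_measure \<nu>"
    and opt: "\<And>m \<tau>. length \<tau> + Suc m = n \<Longrightarrow>
      tree_value w \<theta> (Suc m) \<tau> = w \<tau> + max (tree_value w \<theta> m (\<tau> @ [True])) (tree_value w \<theta> m (\<tau> @ [False]))"
    and "length \<sigma> + m = n"
  shows "(\<Sum>\<tau> | length \<tau> \<le> m. w (\<sigma> @ \<tau>) * \<nu> (\<sigma> @ \<tau>)) \<le> \<nu> \<sigma> * tree_value w \<theta> m \<sigma>"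
  using assms(3)
proof (induction m arbitrary: \<sigma>)
  case (Suc m)
  let ?M = "max (tree_value w \<theta> m (\<sigma> @ [True])) (tree_value w \<theta> m (\<sigma> @ [False]))"
  have nonneg: "0 \<le> \<nu> \<tau>" and add: "\<nu> \<sigma> = \<nu> (\<sigma> @ [False]) + \<nu> (\<sigma> @ [True])" for \<tau>
    using \<nu> unfolding cantor_prob_measure_def by blast+
  have "(\<Sum>\<tau> | length \<tau> \<le> Suc m. w (\<sigma> @ \<tau>) * \<nu> (\<sigma> @ \<tau>)) \<le> w \<sigma> * \<nu> \<sigma>
      + \<nu> (\<sigma> @ [True]) * tree_value w \<theta> m (\<sigma> @ [True]) + \<nu> (\<sigma> @ [False]) * tree_value w \<theta> m (\<sigma> @ [False])"
    using Suc.IH[of "\<sigma> @ [True]"] Suc.IH[of "\<sigma> @ [False]"] Suc.prems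
    by (simp add: sum_bstring_length_le_Suc)
  also have "\<dots> \<le> w \<sigma> * \<nu> \<sigma> + \<nu> (\<sigma> @ [True]) * ?M + \<nu> (\<sigma> @ [False]) * ?M"
    by (intro add_mono mult_left_mono[of _ ?M] nonneg) auto
  also have "\<dots> = \<nu> \<sigma> * tree_value w \<theta> (Suc m) \<sigma>"
    unfolding opt[OF Suc.prems] by (subst (1 2) add) (simp add: algebra_simps)
  finally show ?case .
qed simp

text \<open>The weights depend on \<open>p\<close> itself, so a fixed point is needed to make
  weights and maximiser agree. Comparing conditional values instead of masses makes the choice
  optimal even at nodes of \<open>p\<close>-measure 0, which \<nu> may charge.\<close>

lemma variational_inequality_cantor:
  fixes g :: "(bstring \<Rightarrow> real) \<Rightarrow> bstring \<Rightarrow> real"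
  assumes cont: "continuous_on UNIV g"
  obtains p where "cantor_prob_measure p"
    "\<And>\<nu>. cantor_prob_measure \<nu> \<Longrightarrow>
      (\<Sum>\<tau> | length \<tau> \<le> n. g p \<tau> * \<nu> \<tau>) \<le> (\<Sum>\<tau> | length \<tau> \<le> n. g p \<tau> * p \<tau>)"
proof -
  let ?V = "\<lambda>\<theta>. tree_value (g (choice_measure \<theta>)) \<theta>"
  let ?K = "{x :: bstring \<Rightarrow> real. \<forall>i. x i \<in> {0..1}}"
  \<comment> \<open>The advantage of \<open>True\<close> over \<open>False\<close> with
    \<open>n - Suc (length \<sigma>)\<close> levels left below the children. From depth
    \<open>n\<close> on the truncated subtraction gives 0; \<open>opt\<close> concerns smaller
    depths only.\<close>
  define D where "D \<theta> \<sigma> = ?V \<theta> (n - Suc (length \<sigma>)) (\<sigma> @ [True]) - ?V \<theta> (n - Suc (length \<sigma>)) (\<sigma> @ [False])"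
    for \<theta> \<sigma>
  define f where "f \<theta> \<sigma> = max 0 (min 1 (\<theta> \<sigma> + D \<theta> \<sigma>))" for \<theta> \<sigma>
  have coord: "continuous_on ?K (\<lambda>\<theta> :: bstring \<Rightarrow> real. \<theta> \<tau>)" for \<tau>
    by (rule continuous_on_subset[OF continuous_on_product_coordinates]) simp
  have "continuous_on ?K (\<lambda>\<theta>. g (choice_measure \<theta>))"
    by (rule continuous_on_compose2[OF cont continuous_on_choice_measure]) simp
  then have w: "continuous_on ?K (\<lambda>\<theta>. g (choice_measure \<theta>) \<tau>)" for \<tau>
    by (rule continuous_on_product_then_coordinatewise)
  have "continuous_on ?K (\<lambda>\<theta>. ?V \<theta> m \<sigma>)" for m \<sigma>
  proof (induction m arbitrary: \<sigma>)
    case (Suc m)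
    show ?case
      unfolding tree_value.simps by (intro continuous_intros w coord Suc.IH)
  qed (simp only: tree_value.simps w)
  then have "continuous_on ?K f"
    unfolding f_def [abs_def] D_def
    by (intro continuous_on_coordinatewise_then_product continuous_intros coord)
  moreover have "f \<in> ?K \<rightarrow> ?K"
    by (auto simp: f_def)
  ultimately obtain \<theta> where \<theta>: "\<theta> \<in> ?K" and fix_pt: "f \<theta> = \<theta>"
    by (rule brouwer_countable_cube)
  define p where "p = choice_measure \<theta>"
  have opt: "tree_value (g p) \<theta> (Suc m) \<sigma> =
      g p \<sigma> + max (tree_value (g p) \<theta> m (\<sigma> @ [True])) (tree_value (g p) \<theta> m (\<sigma> @ [False]))"
    if "length \<sigma> + Suc m = n" for m \<sigma>
  proof -
    have m: "n - Suc (length \<sigma>) = m" using that by simp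
    define d where "d = tree_value (g p) \<theta> m (\<sigma> @ [True]) - tree_value (g p) \<theta> m (\<sigma> @ [False])"
    have "max 0 (min 1 (\<theta> \<sigma> + d)) = \<theta> \<sigma>"
      using fun_cong[OF fix_pt, of \<sigma>] by (simp add: f_def D_def m d_def p_def)
    \<comment> \<open>A clamped shift fixes a coordinate only if there is no drift or the coordinate
      already sits at the end it drifts to. In each case the average of the two children's values is
      their maximum.\<close>
    then have "d = 0 \<or> d > 0 \<and> \<theta> \<sigma> = 1 \<or> d < 0 \<and> \<theta> \<sigma> = 0"
      by (auto simp: max_def min_def split: if_splits)
    then show ?thesis by (auto simp: d_def algebra_simps)
  qed
  show thesis
  proof
    show "cantor_prob_measure p"
      unfolding p_def using \<theta> by (intro cantor_prob_measure_choice_measure) auto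
    fix \<nu> assume \<nu>: "cantor_prob_measure \<nu>"
    have "(\<Sum>\<tau> | length \<tau> \<le> n. g p \<tau> * \<nu> \<tau>) \<le> tree_value (g p) \<theta> n []"
    proof -
      have "(\<Sum>\<tau> | length \<tau> \<le> n. g p ([] @ \<tau>) * \<nu> ([] @ \<tau>)) \<le> \<nu> [] * tree_value (g p) \<theta> n []"
        by (rule tree_sum_le_tree_value[OF \<nu> opt]) simp_all
      moreover have "\<nu> [] = 1"
        using \<nu> unfolding cantor_prob_measure_def by blast
      ultimately show ?thesis by simp
    qed
    also have "\<dots> = (\<Sum>\<tau> | length \<tau> \<le> n. g p \<tau> * p \<tau>)"
      using tree_sum_choice_measure[of "g p" "[]" \<theta> n] by (simp add: p_def)
    finally show "(\<Sum>\<tau> | length \<tau> \<le> n. g p \<tau> * \<nu> \<tau>) \<le> (\<Sum>\<tau> | length \<tau> \<le> n. g p \<tau> * p \<tau>)" .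
  qed
qed

section \<open>Measures dominating semimeasures\<close>

text \<open>
  All the mass that a semimeasure loses at a node is passed on to its left child; strings are reversed.
\<close>

primrec push_left :: "(bstring \<Rightarrow> real) \<Rightarrow> bstring \<Rightarrow> real" where
  "push_left x [] = 1"
| "push_left x (b # \<rho>) = (if b then x (rev (b # \<rho>)) else push_left x \<rho> - x (rev (True # \<rho>)))"

lemma measure_above_semimeasure:
  assumes "semimeasure x"
  obtains \<nu> where "cantor_prob_measure \<nu>" "\<And>\<sigma>. x \<sigma> \<le> \<nu> \<sigma>"
proof -
  define \<nu> where "\<nu> \<sigma> = push_left x (rev \<sigma>)" for \<sigma>
  have \<nu> [simp]: "\<nu> [] = 1" "\<nu> (\<sigma> @ [True]) = x (\<sigma> @ [True])" "\<nu> (\<sigma> @ [False]) = \<nu> \<sigma> - x (\<sigma> @ [True])" for \<sigma>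
    by (simp_all add: \<nu>_def)
  have x: "0 \<le> x \<sigma>" "x \<sigma> \<le> 1" "x [] = 1" "x (\<sigma> @ [False]) + x (\<sigma> @ [True]) \<le> x \<sigma>" for \<sigma>
    using assms unfolding semimeasure_def by blast+
  \<comment> \<open>The left child receives \<open>\<nu> \<sigma> - x (\<sigma> @ [True])\<close>,
    which by induction is at least \<open>x \<sigma> - x (\<sigma> @ [True])\<close> and hence at
    least \<open>x (\<sigma> @ [False])\<close>.\<close>
  have bounds: "x \<sigma> \<le> \<nu> \<sigma> \<and> \<nu> \<sigma> \<le> 1" for \<sigma>
  proof (induction \<sigma> rule: rev_induct)
    case (snoc b \<sigma>)
    then show ?case
      using x(4)[of \<sigma>] x(1,2)[of "\<sigma> @ [True]"] by (cases b) auto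
  qed (simp add: x)
  show thesis
  proof
    have "0 \<le> \<nu> \<sigma>" for \<sigma> using bounds[of \<sigma>] x(1)[of \<sigma>] by linarith
    with bounds show "cantor_prob_measure \<nu>" by (simp add: cantor_prob_measure_def)
  qed (use bounds in blast)
qed

section \<open>Directedness of the conditions satisfied by a measure\<close>

lemma A_le_trans: "a \<le>\<^sub>A b \<Longrightarrow> b \<le>\<^sub>A c \<Longrightarrow> a \<le>\<^sub>A c"
  unfolding A_le_def by blast

lemma empty_in_A_cond: "cantor_prob_measure \<mu> \<Longrightarrow> Map.empty \<in> A_cond"
  by (auto simp: A_cond_def satisfies_def)

lemma satisfies_iff: "\<mu> \<Turnstile> f \<longleftrightarrow> (\<forall>\<sigma> l u. f \<sigma> = Some (l, u) \<longrightarrow> l < \<mu> \<sigma> \<and> \<mu> \<sigma> < u)"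
  unfolding satisfies_def dom_def by force

text \<open>Intervals are intersected where both conditions speak; the new endpoints are old ones,
  hence dyadic. Two conditions may be incompatible in general, but here the common \<mu> witnesses
  that the result is again a condition.\<close>

lemma A_cond_join:
  assumes \<mu>: "cantor_prob_measure \<mu>" and a: "a \<in> A_cond" "\<mu> \<Turnstile> a" and b: "b \<in> A_cond" "\<mu> \<Turnstile> b"
  obtains c where "c \<in> A_cond" "\<mu> \<Turnstile> c" "a \<le>\<^sub>A c" "b \<le>\<^sub>A c"
proof -
  define c :: mcond where "c = (\<lambda>\<sigma>. case (a \<sigma>, b \<sigma>) of
      (None, None) \<Rightarrow> None
    | (Some u, None) \<Rightarrow> Some u
    | (None, Some v) \<Rightarrow> Some v
    | (Some u, Some v) \<Rightarrow> Some (max (fst u) (fst v), min (snd u) (snd v)))"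
  have dom: "dom c = dom a \<union> dom b"
    by (auto simp: c_def dom_def split: option.splits)
  have dyadic: "u \<in> nonneg_dyadics \<times> nonneg_dyadics" if "a \<sigma> = Some u \<or> b \<sigma> = Some u" for \<sigma> u
    using that a b unfolding A_cond_def by (auto intro: ranI)
  have sat: "\<mu> \<Turnstile> c"
    using a(2) b(2) unfolding satisfies_iff
    by (auto simp: c_def split: option.splits)
  have "u \<in> nonneg_dyadics \<times> nonneg_dyadics" if "c \<sigma> = Some u" for \<sigma> u
    using that dyadic[of \<sigma> "the (a \<sigma>)"] dyadic[of \<sigma> "the (b \<sigma>)"]
    by (auto simp: c_def max_def min_def split: option.splits if_splits)
  then have "ran c \<subseteq> nonneg_dyadics \<times> nonneg_dyadics"
    by (auto simp: ran_def)
  moreover have "finite (dom c)"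
    using a b unfolding dom A_cond_def by simp
  ultimately have "c \<in> A_cond"
    using sat \<mu> unfolding A_cond_def by blast
  moreover have "a \<le>\<^sub>A c" "b \<le>\<^sub>A c"
    unfolding A_le_def dom by (auto simp: c_def dom_def split: option.splits)
  ultimately show thesis using sat that by blast
qed

lemma A_cond_finite_upper_bound:
  assumes \<mu>: "cantor_prob_measure \<mu>" and "finite F" "\<And>a. a \<in> F \<Longrightarrow> a \<in> A_cond \<and> \<mu> \<Turnstile> a"
  obtains c where "c \<in> A_cond" "\<And>a. a \<in> F \<Longrightarrow> a \<le>\<^sub>A c"
proof -
  \<comment> \<open>\<open>\<mu> \<Turnstile> c\<close> is carried through the induction because the
    next join needs a measure common to both conditions.\<close>
  have "\<exists>c. c \<in> A_cond \<and> \<mu> \<Turnstile> c \<and> (\<forall>a\<in>F. a \<le>\<^sub>A c)"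
    using assms(2,3)
  proof (induction F)
    case empty
    then show ?case using empty_in_A_cond[OF \<mu>] by (auto simp: satisfies_def)
  next
    case (insert a F)
    then obtain c where c: "c \<in> A_cond" "\<mu> \<Turnstile> c" "\<forall>b\<in>F. b \<le>\<^sub>A c" by blast
    obtain d where "d \<in> A_cond" "\<mu> \<Turnstile> d" "a \<le>\<^sub>A d" "c \<le>\<^sub>A d"
      using A_cond_join[OF \<mu> _ _ c(1,2)] insert.prems by blast
    then show ?case using c(3) A_le_trans by blast
  qed
  then show thesis using that by blast
qed

section \<open>Finitely many conditions\<close>

text \<open>A continuous bump function for the open set of \<mu> with
  \<open>\<mu> \<Turnstile> a\<close>. Truncation at 0 keeps negative factors from multiplying to
  something positive.\<close>

definition margin :: "(bstring \<Rightarrow> real) \<Rightarrow> mcond \<Rightarrow> real" where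
  "margin \<mu> a = (\<Prod>\<sigma>\<in>dom a. max 0 (\<mu> \<sigma> - fst (the (a \<sigma>))) * max 0 (snd (the (a \<sigma>)) - \<mu> \<sigma>))"

lemma margin_nonneg: "0 \<le> margin \<mu> a"
  unfolding margin_def by (intro prod_nonneg) simp

lemma margin_pos_iff:
  assumes "finite (dom a)"
  shows "0 < margin \<mu> a \<longleftrightarrow> \<mu> \<Turnstile> a"
proof -
  have "0 < margin \<mu> a \<longleftrightarrow> margin \<mu> a \<noteq> 0"
    using margin_nonneg[of \<mu> a] by auto
  also have "\<dots> \<longleftrightarrow> (\<forall>\<sigma>\<in>dom a. max 0 (\<mu> \<sigma> - fst (the (a \<sigma>))) * max 0 (snd (the (a \<sigma>)) - \<mu> \<sigma>) \<noteq> 0)"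
    unfolding margin_def prod_zero_iff[OF assms] by blast
  also have "\<dots> \<longleftrightarrow> \<mu> \<Turnstile> a"
  proof -
    have "max 0 x * max 0 y \<noteq> 0 \<longleftrightarrow> 0 < x \<and> 0 < y" for x y :: real
      by (auto simp: max_def)
    then show ?thesis unfolding satisfies_def by (simp only: diff_gt_0_iff_gt)
  qed
  finally show ?thesis .
qed

lemma continuous_on_margin: "continuous_on S (\<lambda>\<mu>. margin \<mu> a)"
proof -
  have "continuous_on S (\<lambda>\<theta> :: bstring \<Rightarrow> real. \<theta> \<tau>)" for \<tau>
    by (rule continuous_on_subset[OF continuous_on_product_coordinates]) simp
  then show ?thesis
    unfolding margin_def by (intro continuous_intros)
qed

text \<open>At a violation,
  \<open>p \<tau> < T a \<tau> \<le> T c \<tau> \<le> \<nu> \<tau>\<close>. Replacing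
  \<open>p\<close> by \<nu> would strictly increase the weighted sum there and decrease no other
  term, against the variational inequality.\<close>

lemma passes_finite_part:
  assumes T: "is_test T" and F: "finite F" "F \<subseteq> A_cond"
  obtains p where "cantor_prob_measure p"
    "\<And>a \<tau>. a \<in> F \<Longrightarrow> p \<Turnstile> a \<Longrightarrow> length \<tau> \<le> n \<Longrightarrow> T a \<tau> \<le> p \<tau>"
proof -
  define g where "g p \<tau> = (\<Sum>a\<in>F. margin p a * max 0 (T a \<tau> - p \<tau>))" for p \<tau>
  have coord: "continuous_on UNIV (\<lambda>\<theta> :: bstring \<Rightarrow> real. \<theta> \<tau>)" for \<tau> by simp
  have "continuous_on UNIV g"
    unfolding g_def [abs_def]
    by (intro continuous_on_coordinatewise_then_product continuous_intros continuous_on_margin coord)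
  then obtain p where p: "cantor_prob_measure p" and
    VI: "\<And>\<nu>. cantor_prob_measure \<nu> \<Longrightarrow>
      (\<Sum>\<tau> | length \<tau> \<le> n. g p \<tau> * \<nu> \<tau>) \<le> (\<Sum>\<tau> | length \<tau> \<le> n. g p \<tau> * p \<tau>)"
    by (rule variational_inequality_cantor[where n = n]) blast
  have "finite {a \<in> F. p \<Turnstile> a}" using F by simp
  \<comment> \<open>Only the conditions that \<open>p\<close> satisfies are bounded, with
    \<open>p\<close> as their common measure; the others have margin 0 and contribute nothing to
    \<open>g p\<close>.\<close>
  then obtain c where c: "c \<in> A_cond" "\<And>a. a \<in> F \<Longrightarrow> p \<Turnstile> a \<Longrightarrow> a \<le>\<^sub>A c"
    using F(2) by (elim A_cond_finite_upper_bound[OF p]) auto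
  have "semimeasure (T c)"
    using T c(1) by (auto simp: is_test_def B_cond_def)
  then obtain \<nu> where \<nu>: "cantor_prob_measure \<nu>" "\<And>\<sigma>. T c \<sigma> \<le> \<nu> \<sigma>"
    by (rule measure_above_semimeasure) blast
  have above: "T a \<tau> \<le> \<nu> \<tau>" if "a \<in> F" "p \<Turnstile> a" for a \<tau>
  proof -
    have "T a \<le>\<^sub>B T c"
      using T c that F(2) unfolding is_test_def monotone_on_def by blast
    then show ?thesis using \<nu>(2)[of \<tau>] by (auto simp: B_le_def intro: order_trans)
  qed
  have fin: "finite (dom a)" if "a \<in> F" for a
    using that F(2) by (auto simp: A_cond_def)
  have pos: "p \<tau> < \<nu> \<tau> \<and> 0 < g p \<tau>" if "a \<in> F" "p \<Turnstile> a" "p \<tau> < T a \<tau>" for a \<tau>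
  proof -
    have "0 < margin p a * max 0 (T a \<tau> - p \<tau>)"
      using that margin_pos_iff[OF fin] by simp
    also have "\<dots> \<le> g p \<tau>"
      unfolding g_def using that(1) F(1)
      by (intro member_le_sum) (auto intro!: mult_nonneg_nonneg margin_nonneg)
    finally show ?thesis using above[OF that(1,2), of \<tau>] that(3) by simp
  qed
  have gain: "0 \<le> g p \<tau> * (\<nu> \<tau> - p \<tau>)" for \<tau>
  proof (cases "\<exists>a\<in>F. p \<Turnstile> a \<and> p \<tau> < T a \<tau>")
    case True
    then show ?thesis using pos[of _ \<tau>] by (force intro: mult_nonneg_nonneg)
  next
    case False
    have "margin p a * max 0 (T a \<tau> - p \<tau>) = 0" if "a \<in> F" for a
      using that False margin_pos_iff[OF fin[OF that], of p] margin_nonneg[of p a] by (cases "p \<Turnstile> a") auto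
    then have "g p \<tau> = 0" unfolding g_def by (intro sum.neutral) blast
    then show ?thesis by simp
  qed
  have "(\<Sum>\<tau> | length \<tau> \<le> n. g p \<tau> * (\<nu> \<tau> - p \<tau>)) \<le> 0"
    using VI[OF \<nu>(1)] by (simp add: right_diff_distrib sum_subtractf)
  then have "(\<Sum>\<tau> | length \<tau> \<le> n. g p \<tau> * (\<nu> \<tau> - p \<tau>)) = 0"
    using gain by (intro antisym sum_nonneg)
  then have zero: "g p \<tau> * (\<nu> \<tau> - p \<tau>) = 0" if "length \<tau> \<le> n" for \<tau>
    using gain that by (subst (asm) sum_nonneg_eq_0_iff) auto
  show thesis
  proof (rule that[OF p])
    fix a and \<tau> :: bstring assume "a \<in> F" "p \<Turnstile> a" "length \<tau> \<le> n"
    then show "T a \<tau> \<le> p \<tau>"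
      using zero[of \<tau>] pos[of a \<tau>] by (force simp: not_le)
  qed
qed

section \<open>Compactness and the passage to all conditions\<close>

lemma compact_cantor_prob_measures: "compact {\<mu>. cantor_prob_measure \<mu>}"
proof -
  have coord: "continuous_on UNIV (\<lambda>\<theta> :: bstring \<Rightarrow> real. \<theta> \<tau>)" for \<tau> by simp
  have "{\<mu>. cantor_prob_measure \<mu>} = {\<mu>. \<forall>\<sigma>. \<mu> \<sigma> \<in> {0..1}} \<inter>
      ({\<mu>. \<mu> [] = 1} \<inter> (\<Inter>\<sigma>. {\<mu>. \<mu> \<sigma> = \<mu> (\<sigma> @ [False]) + \<mu> (\<sigma> @ [True])}))"
    by (auto simp: cantor_prob_measure_def)
  moreover have "closed ({\<mu> :: bstring \<Rightarrow> real. \<mu> [] = 1} \<inter> (\<Inter>\<sigma>. {\<mu>. \<mu> \<sigma> = \<mu> (\<sigma> @ [False]) + \<mu> (\<sigma> @ [True])}))"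
    by (intro closed_Int closed_INT ballI closed_Collect_eq continuous_intros coord)
  ultimately show ?thesis
    by (simp add: compact_Int_closed compact_cube del: atLeastAtMost_iff)
qed

theorem theorem4p3:
  fixes T :: "mcond \<Rightarrow> bstring \<Rightarrow> real"
  assumes "is_test T"
  shows "\<exists>\<mu>. cantor_prob_measure \<mu> \<and> passes \<mu> T"
proof -
  let ?I = "A_cond \<times> (UNIV :: bstring set)"
  \<comment> \<open>The implication from \<open>\<mu> \<Turnstile> a\<close> to
    \<open>T a \<tau> \<le> \<mu> \<tau>\<close> is written as the vanishing of a continuous
    function, which makes each \<open>C (a, \<tau>)\<close> closed.\<close>
  define C where "C = (\<lambda>(a, \<tau>). {\<mu> :: bstring \<Rightarrow> real. margin \<mu> a * max 0 (T a \<tau> - \<mu> \<tau>) = 0})"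
  have C_iff: "\<mu> \<in> C (a, \<tau>) \<longleftrightarrow> (\<mu> \<Turnstile> a \<longrightarrow> T a \<tau> \<le> \<mu> \<tau>)" if "a \<in> A_cond" for \<mu> a \<tau>
  proof -
    have "finite (dom a)" using that by (simp add: A_cond_def)
    then show ?thesis
      using margin_pos_iff[of a \<mu>] margin_nonneg[of \<mu> a] by (auto simp: C_def max_def not_le)
  qed
  have coord: "continuous_on UNIV (\<lambda>\<theta> :: bstring \<Rightarrow> real. \<theta> \<tau>)" for \<tau> by simp
  have "{\<mu>. cantor_prob_measure \<mu>} \<inter> (\<Inter>k\<in>?I. C k) \<noteq> {}"
  proof (rule compact_imp_fip_image[OF compact_cantor_prob_measures])
    fix k assume "k \<in> ?I"
    show "closed (C k)"
      unfolding C_def split_beta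
      by (intro closed_Collect_eq continuous_intros continuous_on_margin coord)
  next
    fix J assume J: "finite J" "J \<subseteq> ?I"
    \<comment> \<open>Finitely many pairs involve finitely many conditions and strings of bounded
      length, the case of \<open>passes_finite_part\<close>. The inserted 0 covers empty
      \<open>J\<close>.\<close>
    define n where "n = Max (insert 0 (length ` snd ` J))"
    have n: "length \<tau> \<le> n" if "(a, \<tau>) \<in> J" for a \<tau>
      unfolding n_def using J(1) that by (intro Max_ge) force+
    obtain p where "cantor_prob_measure p"
      "\<And>a \<tau>. a \<in> fst ` J \<Longrightarrow> p \<Turnstile> a \<Longrightarrow> length \<tau> \<le> n \<Longrightarrow> T a \<tau> \<le> p \<tau>"
      by (rule passes_finite_part[OF assms, of "fst ` J" n]) (use J in auto)
    moreover from this have "p \<in> C k" if "k \<in> J" for k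
      using that J(2) n C_iff[of "fst k" p "snd k"] by (cases k) force
    ultimately show "{\<mu>. cantor_prob_measure \<mu>} \<inter> (\<Inter>k\<in>J. C k) \<noteq> {}"
      by blast
  qed
  then obtain \<mu> where \<mu>: "cantor_prob_measure \<mu>" and "\<And>k. k \<in> ?I \<Longrightarrow> \<mu> \<in> C k"
    by blast
  then have le: "T a \<tau> \<le> \<mu> \<tau>" if "a \<in> A_cond" "\<mu> \<Turnstile> a" for a \<tau>
    using that C_iff by blast
  have "test_value T \<mu> \<sigma> \<le> \<mu> \<sigma>" for \<sigma>
    unfolding test_value_def
  proof (rule cSup_least)
    have "Map.empty \<in> A_cond" "\<mu> \<Turnstile> Map.empty"
      using empty_in_A_cond[OF \<mu>] by (simp_all add: satisfies_def)
    then show "{T a \<sigma> |a. a \<in> A_cond \<and> \<mu> \<Turnstile> a} \<noteq> {}" by blast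
  qed (use le in auto)
  with \<mu> show ?thesis by (auto simp: passes_def)
qed

end
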